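(* Let $(a_n)_{n\ge0}$ be the sequence, listed in increasing order, of the non-negative integers $m$ such that $840m+121$ is a perfect square. Then $$\sum_{n=0}^\infty(-1)^{\lfloor (n+4)/8\rfloor}q^{a_n}=\frac{(q^2,q^5,q^7;q^7)_\infty}{(q,q^4;q^5)_\infty}.$$
   Context: Here $q$ is a complex number with $|q|<1$ (equivalently, the identity may be read as an identity of formal power series in $q$). For a complex number $a$, $(a;q)_\infty:=\prod_{i=0}^\infty(1-aq^i)$, and $(a_1,a_2,\dots,a_m;q)_\infty:=\prod_{j=1}^m(a_j;q)_\infty$. $\lfloor x\rfloor$ is the floor function. *)

theory Defs
  imports "HOL-Analysis.Analysis" "HOL-Computational_Algebra.Nth_Powers"
begin

definition qpoch_inf :: "complex \<Rightarrow> complex \<Rightarrow> complex" where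
  "qpoch_inf a q = (\<Prod>i. 1 - a * q ^ i)"

definition qpochs_inf :: "complex list \<Rightarrow> complex \<Rightarrow> complex" where
  "qpochs_inf as q = (\<Prod>a\<leftarrow>as. qpoch_inf a q)"

text \<open>The value of \<^const>\<open>prodinf\<close> is unspecified for divergent products, so we record
  convergence for \<open>\<bar>q\<bar> < 1\<close>.\<close>

lemma convergent_prod_qpoch_inf:
  fixes a q :: complex
  assumes "norm q < 1"
  shows "convergent_prod (\<lambda>i. 1 - a * q ^ i)"
proof -
  have "summable (\<lambda>i. norm (- (a * q ^ i)))"
    using assms by (simp add: norm_mult norm_power summable_mult summable_geometric)
  then show ?thesis
    using summable_imp_convergent_prod_complex[of "\<lambda>i. - (a * q ^ i)"]
      abs_convergent_prod_imp_convergent_prod[of "\<lambda>i. 1 - a * q ^ i"]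
    by (simp add: abs_convergent_prod_conv_summable)
qed

definition square_exponents :: "nat set" where
  "square_exponents = {m. is_square (840 * m + 121)}"

text \<open>\<^const>\<open>enumerate\<close> lists a set of naturals in increasing order provided the set is
  infinite.\<close>

lemma infinite_square_exponents: "infinite square_exponents"
proof -
  have "840 * t ^ 2 + 22 * t \<in> square_exponents" for t
  proof -
    have "840 * (840 * t ^ 2 + 22 * t) + 121 = (840 * t + 11) ^ 2"
      by (simp add: power2_eq_square algebra_simps)
    then show ?thesis
      unfolding square_exponents_def is_nth_power_def by blast
  qed
  moreover have "n \<le> 840 * n ^ 2 + 22 * n" for n :: nat
    by simp
  ultimately show ?thesis
    unfolding infinite_nat_iff_unbounded_le by blast
qed

end

theory Submission
  imports Defs "HOL-Library.Nat_Bijection"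
begin

text \<open>
  Write \<open>q = w\<^sup>8\<^sup>4\<^sup>0\<close>. After multiplication by a power of \<open>w\<close>, Jacobi's triple product turns
  \<open>(q\<^sup>2,q\<^sup>5,q\<^sup>7;q\<^sup>7)\<close>, \<open>(q\<^sup>2,q\<^sup>3,q\<^sup>5;q\<^sup>5)\<close> and \<open>(q;q)\<close> into alternating sums of \<open>w\<close> to the powers
  \<open>15A\<^sup>2\<close>, \<open>21B\<^sup>2\<close> and \<open>35C\<^sup>2\<close>, where \<open>A = 14n+3\<close>, \<open>B = 10m+1\<close>, \<open>C = 6j+1\<close>, while the series side is a
  signed sum of \<open>w\<close> to the powers \<open>x\<^sup>2\<close> with \<open>x = 210k+r\<close>. As \<open>(q;q) = (q,q\<^sup>4;q\<^sup>5)(q\<^sup>2,q\<^sup>3,q\<^sup>5;q\<^sup>5)\<close>, it remains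
  to equate the double sums over \<open>(A,B)\<close> and over \<open>(C,x)\<close>. The substitution \<open>C = (A+B)/2\<close>, \<open>x = (5A-7B)/2\<close>,
  which is multiplication by an element of norm 15 in \<open>\<rat>(\<surd>-35)\<close>, gives \<open>15A\<^sup>2 + 21B\<^sup>2 = 35C\<^sup>2 + x\<^sup>2\<close>.
  Both double sums are parts of one signed sum over a union of lattice cosets of pairs \<open>(A,B)\<close>: the first is
  its part with \<open>A\<close> odd, the second its part with \<open>A+B\<close> prime to 3. The complements cancel
  under \<open>(A,B) \<mapsto> (A,-B)\<close> and, with \<open>A+B = 6c\<close>, under \<open>(A,B) \<mapsto> (A-7c,B-5c)\<close>.
\<close>

no_notation Infinite_Set_Sum.abs_summable_on (infix \<open>abs'_summable'_on\<close> 50)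

subsection \<open>The Jacobi triple product\<close>

text \<open>These are the terms of Ramanujan's \<open>f(-x,-y)\<close>; the symmetric form keeps all exponents natural.\<close>

definition theta_term :: "complex \<Rightarrow> complex \<Rightarrow> int \<Rightarrow> complex" where
  "theta_term x y j = (-1) ^ nat \<bar>j\<bar> * x ^ nat (j * (j + 1) div 2) * y ^ nat (j * (j - 1) div 2)"

section \<open>Gaussian binomials and the finite triple product\<close>

definition qfact :: "complex \<Rightarrow> nat \<Rightarrow> complex" where
  "qfact Q n = (\<Prod>i<n. 1 - Q ^ Suc i)"

text \<open>The quotient form gives limits and uniform bounds directly. The value 0 beyond
  \<open>k = n\<close> lets Pascal's rule and sums run one place past the end of a row.\<close>

definition qbinom :: "complex \<Rightarrow> nat \<Rightarrow> nat \<Rightarrow> complex" where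
  "qbinom Q n k = (if k \<le> n then qfact Q n / (qfact Q k * qfact Q (n - k)) else 0)"

lemma one_minus_power_nonzero:
  fixes Q :: complex
  assumes "norm Q < 1" "n > 0"
  shows "1 - Q ^ n \<noteq> 0"
proof
  assume "1 - Q ^ n = 0"
  then have "norm Q ^ n = 1"
    by (metis eq_iff_diff_eq_0 norm_one norm_power)
  moreover have "norm Q ^ n < 1"
    using assms by (simp add: power_less_one_iff)
  ultimately show False by simp
qed

lemma qfact_nonzero: "norm Q < 1 \<Longrightarrow> qfact Q n \<noteq> 0"
  using one_minus_power_nonzero[of Q "Suc _"] by (auto simp: qfact_def simp del: power_Suc)

lemma qfact_Suc: "qfact Q (Suc n) = qfact Q n * (1 - Q ^ Suc n)"
  by (simp add: qfact_def)

lemma qbinom_0: "norm Q < 1 \<Longrightarrow> qbinom Q n 0 = 1"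
  using qfact_nonzero[of Q n] by (simp add: qbinom_def) (simp add: qfact_def)

lemma qbinom_sym: "k \<le> n \<Longrightarrow> qbinom Q n (n - k) = qbinom Q n k"
  by (simp add: qbinom_def mult.commute)

text \<open>The factor \<open>1 - Q ^ (a + b)\<close> of the numerator splits as
  \<open>(1 - Q ^ b) + Q ^ b * (1 - Q ^ a)\<close>, and each part cancels one factor of the
  denominator.\<close>

lemma qbinom_Suc_Suc:
  assumes Q: "norm Q < 1" and k: "k \<le> n"
  shows "qbinom Q (Suc n) (Suc k) = qbinom Q n (Suc k) + Q ^ (n - k) * qbinom Q n k"
proof (cases "k = n")
  case True
  then show ?thesis
    using qfact_nonzero[OF Q] by (simp add: qbinom_def)
next
  case False
  then obtain l where l: "n = k + Suc l"
    using k by (metis add_Suc_right less_imp_Suc_add order_le_imp_less_or_eq)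
  note nz = qfact_nonzero[OF Q]
    one_minus_power_nonzero[OF Q, of "Suc k", simplified] one_minus_power_nonzero[OF Q, of "Suc l", simplified]
  have "qbinom Q (Suc n) (Suc k) =
     qfact Q n * (1 - Q ^ (Suc k + Suc l)) / (qfact Q k * (1 - Q ^ Suc k) * (qfact Q l * (1 - Q ^ Suc l)))"
    by (simp add: qbinom_def l qfact_Suc)
  also have "1 - Q ^ (Suc k + Suc l) = (1 - Q ^ Suc l) + Q ^ Suc l * (1 - Q ^ Suc k)"
    by (simp add: algebra_simps power_add)
  also have "qfact Q n * \<dots> / (qfact Q k * (1 - Q ^ Suc k) * (qfact Q l * (1 - Q ^ Suc l))) =
     qfact Q n / (qfact Q k * (1 - Q ^ Suc k) * qfact Q l)
       + Q ^ Suc l * (qfact Q n / (qfact Q k * (qfact Q l * (1 - Q ^ Suc l))))"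
    using nz by (simp add: divide_simps) (simp add: algebra_simps)
  also have "\<dots> = qbinom Q n (Suc k) + Q ^ (n - k) * qbinom Q n k"
    by (simp add: qbinom_def l qfact_Suc)
  finally show ?thesis .
qed

lemma nat_triangle:
  fixes j :: int
  obtains a b where "j * (j + 1) div 2 = int a" "j * (j - 1) div 2 = int b"
    "2 * int a = j * (j + 1)" "2 * int b = j * (j - 1)"
proof -
  have "even (j * (j + 1))" "even (j * (j - 1))" by auto
  moreover have "j * (j + 1) \<ge> 0" "j * (j - 1) \<ge> 0"
    by (cases "j \<ge> 0"; cases "j \<ge> 1"; force simp: zero_le_mult_iff)+
  ultimately show ?thesis
    by (intro that[of "nat (j * (j + 1) div 2)" "nat (j * (j - 1) div 2)"]) auto
qed

lemma theta_term_neg: "theta_term x y (- j) = theta_term y x j"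
  by (simp add: theta_term_def algebra_simps)

text \<open>Consecutive terms have the formal ratio \<open>- x * (x * y) ^ j\<close>. As
  \<open>j\<close> may be negative, the missing power \<open>m - j\<close> stands on the
  left.\<close>

lemma theta_term_step:
  assumes "j \<le> int m"
  shows "theta_term x y (j + 1) * (x * y) ^ nat (int m - j) = - x * (x * y) ^ m * theta_term x y j"
proof -
  obtain a b where ab: "j * (j + 1) div 2 = int a" "j * (j - 1) div 2 = int b"
    "2 * int a = j * (j + 1)" "2 * int b = j * (j - 1)"
    by (rule nat_triangle)
  obtain c d where cd: "(j+1) * (j + 1+1) div 2 = int c" "(j+1) * (j+1 - 1) div 2 = int d"
    "2 * int c = (j+1) * (j+1 + 1)" "2 * int d = (j+1) * (j+1 - 1)"
    by (rule nat_triangle)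
  define l where "l = nat (int m - j)"
  have l: "int l = int m - j" using assms by (simp add: l_def)
  have 1: "c + l = a + m + 1" and 2: "d + l = b + m"
    using ab(3,4) cd(3,4) l by (simp_all add: algebra_simps flip: of_nat_eq_iff[where 'a=int])
  have sgn: "(-1::complex) ^ nat \<bar>j + 1\<bar> = - ((-1) ^ nat \<bar>j\<bar>)"
    by (simp add: minus_one_power_iff even_nat_iff)
  have "theta_term x y (j + 1) * (x * y) ^ l = - ((-1) ^ nat \<bar>j\<bar>) * x ^ (c + l) * y ^ (d + l)"
    unfolding theta_term_def sgn cd nat_int by (simp add: power_add power_mult_distrib)
  also have "\<dots> = - x * (x * y) ^ m * theta_term x y j"
    unfolding theta_term_def ab nat_int 1 2 by (simp add: power_add power_mult_distrib)
  finally show ?thesis by (simp add: l_def)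
qed

text \<open>Cauchy's finite form of the triple product: a q-binomial sum with index shifted by
  \<open>n\<close>, which will factor into \<open>m\<close> factors from \<open>x\<close> and
  \<open>n\<close> from \<open>y\<close>.\<close>

definition theta_finite :: "complex \<Rightarrow> complex \<Rightarrow> nat \<Rightarrow> nat \<Rightarrow> complex" where
  "theta_finite x y m n = (\<Sum>k\<le>m + n. theta_term x y (int k - int n) * qbinom (x * y) (m + n) k)"

text \<open>Reversing the summation negates the index of the theta term and so exchanges
  \<open>x\<close> and \<open>y\<close>. Induction on \<open>n\<close> thereby reduces to the step
  in \<open>m\<close>.\<close>

lemma theta_finite_sym: "theta_finite x y m n = theta_finite y x n m"
  unfolding theta_finite_def
proof (rule sum.reindex_bij_witness[of _ "\<lambda>k. m + n - k" "\<lambda>k. m + n - k"])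
  fix k assume "k \<in> {..m + n}"
  then have k: "k \<le> m + n" by simp
  then have "int (m + n - k) - int m = - (int k - int n)" by simp
  then show "theta_term y x (int (m + n - k) - int m) * qbinom (y * x) (n + m) (m + n - k) =
    theta_term x y (int k - int n) * qbinom (x * y) (m + n) k"
    using qbinom_sym[OF k] by (simp only: theta_term_neg mult.commute[of y x] add.commute[of n m])
qed auto

text \<open>The q-Pascal rule splits the longer row in two; by \<open>theta_term_step\<close> the
  second part is the old sum times \<open>- x * (x * y) ^ m\<close>.\<close>

lemma theta_finite_Suc:
  assumes "norm (x * y) < 1"
  shows "theta_finite x y (Suc m) n = (1 - x * (x * y) ^ m) * theta_finite x y m n"
proof -
  let ?Q = "x * y" and ?t = "\<lambda>k. theta_term x y (int k - int n)" and ?N = "m + n"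
  have "theta_finite x y (Suc m) n = ?t 0 * qbinom ?Q (Suc ?N) 0
      + (\<Sum>k\<le>?N. ?t (Suc k) * qbinom ?Q (Suc ?N) (Suc k))"
    unfolding theta_finite_def by (simp add: sum.atMost_Suc_shift del: sum.atMost_Suc)
  also have "(\<Sum>k\<le>?N. ?t (Suc k) * qbinom ?Q (Suc ?N) (Suc k)) =
     (\<Sum>k\<le>?N. ?t (Suc k) * qbinom ?Q ?N (Suc k))
     + (\<Sum>k\<le>?N. - x * ?Q ^ m * (?t k * qbinom ?Q ?N k))"
    unfolding sum.distrib[symmetric]
  proof (rule sum.cong[OF refl])
    fix k assume "k \<in> {..?N}"
    then have k: "k \<le> ?N" by simp
    have "?t (Suc k) * ?Q ^ (?N - k) = - x * ?Q ^ m * ?t k"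
    proof -
      have "nat (int m - (int k - int n)) = ?N - k" "int (Suc k) - int n = int k - int n + 1"
        "int k - int n \<le> int m"
        using k by linarith+
      then show ?thesis using theta_term_step[of "int k - int n" m x y] by (simp only:)
    qed
    then show "?t (Suc k) * qbinom ?Q (Suc ?N) (Suc k) =
       ?t (Suc k) * qbinom ?Q ?N (Suc k) + - x * ?Q ^ m * (?t k * qbinom ?Q ?N k)"
      unfolding qbinom_Suc_Suc[OF assms k] by (simp only: distrib_left mult.assoc[symmetric])
  qed
  also have "?t 0 * qbinom ?Q (Suc ?N) 0 + ((\<Sum>k\<le>?N. ?t (Suc k) * qbinom ?Q ?N (Suc k))
     + (\<Sum>k\<le>?N. - x * ?Q ^ m * (?t k * qbinom ?Q ?N k))) =
     (\<Sum>k\<le>Suc ?N. ?t k * qbinom ?Q ?N k) - x * ?Q ^ m * theta_finite x y m n"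
    unfolding sum.atMost_Suc_shift theta_finite_def
    using assms by (simp add: qbinom_0 sum_distrib_left sum_negf mult.assoc)
  \<comment> \<open>The extra last term vanishes by the default value of
    \<open>qbinom\<close>.\<close>
  also have "(\<Sum>k\<le>Suc ?N. ?t k * qbinom ?Q ?N k) = theta_finite x y m n"
    by (simp add: theta_finite_def qbinom_def)
  finally show ?thesis by (simp add: algebra_simps)
qed

lemma theta_finite_eq_prod:
  assumes "norm (x * y) < 1"
  shows "theta_finite x y m n = (\<Prod>i<m. 1 - x * (x * y) ^ i) * (\<Prod>i<n. 1 - y * (x * y) ^ i)"
proof (induction m)
  case 0
  show ?case
  proof (induction n)
    case 0
    show ?case by (simp add: theta_finite_def theta_term_def qbinom_def qfact_def)
  next
    case (Suc n)
    then show ?case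
      using theta_finite_Suc[of y x n 0] assms
      by (simp add: theta_finite_sym[of x y] mult.commute)
  qed
qed (use theta_finite_Suc[OF assms] in simp)

section \<open>Passage to the limit in the finite triple product\<close>

text \<open>Tannery's theorem (dominated convergence for series), carried from the naturals to the
  integers by the bijection \<open>int_decode\<close>.\<close>

lemma has_sum_int_dominated:
  fixes a :: "nat \<Rightarrow> int \<Rightarrow> complex"
  assumes lim: "\<And>j. (\<lambda>n. a n j) \<longlonglongrightarrow> b j"
    and bound: "\<And>n j. norm (a n j) \<le> M j"
    and M: "M summable_on UNIV"
    and sum: "\<And>n. (a n has_sum s n) UNIV"
    and s: "s \<longlonglongrightarrow> S"
  shows "(b has_sum S) UNIV"
proof -
  have M': "summable (\<lambda>k. M (int_decode k))"
    using M summable_on_reindex_bij_betw[OF bij_int_decode, of M]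
    by (simp add: summable_on_imp_summable)
  have T: "summable (\<lambda>k. norm (b (int_decode k))) \<and>
      (\<lambda>n. \<Sum>k. a n (int_decode k)) \<longlonglongrightarrow> (\<Sum>k. b (int_decode k))"
    using tannerys_theorem[of "\<lambda>k n. a n (int_decode k)" "\<lambda>k. b (int_decode k)" sequentially
        "\<lambda>k. M (int_decode k)"] lim M' bound by (simp add: case_prod_unfold)
  have "(\<Sum>k. a n (int_decode k)) = s n" for n
    using sum[of n] has_sum_reindex_bij_betw[OF bij_int_decode, of "a n"]
    by (metis has_sum_imp_sums sums_unique)
  with T s have "(\<Sum>k. b (int_decode k)) = S"
    by (auto intro: LIMSEQ_unique)
  with T have "((\<lambda>k. b (int_decode k)) has_sum S) UNIV"
    by (metis norm_summable_imp_has_sum summable_norm_cancel summable_sums)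
  then show ?thesis
    using has_sum_reindex_bij_betw[OF bij_int_decode, of b] by simp
qed

lemma summable_on_int_geometric:
  fixes r :: real
  assumes "0 \<le> r" "r < 1"
  shows "(\<lambda>j::int. r ^ nat \<bar>j\<bar>) summable_on UNIV"
proof -
  have g: "(\<lambda>n::nat. r ^ n) summable_on UNIV"
    using assms by (intro norm_summable_imp_summable_on) (simp add: summable_geometric)
  have 1: "(\<lambda>j::int. r ^ nat \<bar>j\<bar>) summable_on range int"
    using g by (subst summable_on_reindex) (auto simp: o_def)
  have 2: "(\<lambda>j::int. r ^ nat \<bar>j\<bar>) summable_on range (\<lambda>n. - int n)"
    using g by (subst summable_on_reindex) (auto simp: o_def inj_on_def)
  \<comment> \<open>Zero lies in both ranges, so it is removed from the second to make the union
    disjoint.\<close>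
  have "(UNIV::int set) = range int \<union> (range (\<lambda>n. - int n) - range int)"
    by (auto simp: image_iff) (metis int_cases2)
  then show ?thesis
    using 1 summable_on_subset_banach[OF 2, of "range (\<lambda>n. - int n) - range int"]
    by (metis Diff_disjoint Diff_subset summable_on_Un_disjoint)
qed

text \<open>The two exponents add up to the square of \<open>j\<close>, which is at least its
  absolute value.\<close>

lemma norm_theta_term_le:
  assumes "norm x \<le> r" "norm y \<le> r" "r < 1"
  shows "norm (theta_term x y j) \<le> r ^ nat \<bar>j\<bar>"
proof -
  obtain a b where ab: "j * (j + 1) div 2 = int a" "j * (j - 1) div 2 = int b"
    "2 * int a = j * (j + 1)" "2 * int b = j * (j - 1)"
    by (rule nat_triangle)
  have r: "r \<ge> 0" using assms(1) norm_ge_zero order_trans by blast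
  have "int (a + b) = j * j" using ab(3,4) by (simp add: algebra_simps)
  moreover have "\<bar>j\<bar> \<le> j * j"
    using self_le_power[of "\<bar>j\<bar>" 2] by (cases "j = 0") (auto simp: power2_eq_square)
  ultimately have le: "nat \<bar>j\<bar> \<le> a + b" by linarith
  have "norm (theta_term x y j) \<le> r ^ a * r ^ b"
    unfolding theta_term_def ab nat_int norm_mult norm_power using assms r
    by (auto intro!: mult_mono power_mono)
  also have "\<dots> \<le> r ^ nat \<bar>j\<bar>"
    using le assms r by (simp add: power_decreasing flip: power_add)
  finally show ?thesis .
qed

lemma qpoch_inf_LIMSEQ:
  assumes "norm q < 1"
  shows "(\<lambda>n. \<Prod>i<n. 1 - a * q ^ i) \<longlonglongrightarrow> qpoch_inf a q"
proof -
  have "(\<lambda>n. \<Prod>i\<le>n. 1 - a * q ^ i) \<longlonglongrightarrow> qpoch_inf a q"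
    unfolding qpoch_inf_def by (intro convergent_prod_LIMSEQ convergent_prod_qpoch_inf assms)
  then show ?thesis
    by (subst filterlim_sequentially_Suc[symmetric]) (simp add: lessThan_Suc_atMost)
qed

lemma qpoch_inf_nonzero:
  assumes "norm q < 1" "\<And>i. a * q ^ i \<noteq> 1"
  shows "qpoch_inf a q \<noteq> 0"
  unfolding qpoch_inf_def using assms
  by (intro prodinf_nonzero convergent_prod_qpoch_inf) (auto simp: eq_commute[of 1])

lemma qpoch_inf_power_nonzero:
  assumes "norm q < 1" "k > 0" "M > 0"
  shows "qpoch_inf (q ^ k) (q ^ M) \<noteq> 0"
proof (rule qpoch_inf_nonzero)
  show "norm (q ^ M) < 1"
    using assms by (simp add: norm_power power_less_one_iff)
  show "q ^ k * (q ^ M) ^ i \<noteq> 1" for i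
    using one_minus_power_nonzero[OF assms(1), of "k + M * i"] assms(2)
    by (simp add: power_add power_mult)
qed

theorem jacobi_triple_product:
  assumes x: "norm x < 1" and y: "norm y < 1"
  shows "(theta_term x y has_sum qpochs_inf [x, y, x * y] (x * y)) UNIV"
proof -
  define Q where "Q = x * y"
  have Q: "norm Q < 1"
    unfolding Q_def norm_mult using x y
    by (metis mult_less_cancel_left1 mult_left_le norm_ge_zero order_le_less_trans order_less_imp_le)
  define P where "P = qpoch_inf Q Q"
  have P: "qfact Q \<longlonglongrightarrow> P"
    using qpoch_inf_LIMSEQ[OF Q, of Q] unfolding P_def qfact_def by simp
  have P0: "P \<noteq> 0"
    using qpoch_inf_power_nonzero[OF Q, of 1 1] by (simp add: P_def)
  \<comment> \<open>Since \<open>qfact Q\<close> converges to a nonzero limit, it and its inverse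
    are bounded; hence all Gaussian binomials share one bound.\<close>
  obtain U where U: "\<And>n. norm (qfact Q n) \<le> U"
    using P by (metis Bseq_def convergentI convergent_imp_Bseq)
  have "(\<lambda>n. inverse (qfact Q n)) \<longlonglongrightarrow> inverse P"
    using P P0 by (rule tendsto_inverse)
  then obtain L where L: "\<And>n. norm (inverse (qfact Q n)) \<le> L"
    by (metis Bseq_def convergentI convergent_imp_Bseq)
  have U0: "U \<ge> 0" and L0: "L \<ge> 0"
    using U[of 0] L[of 0] norm_ge_zero order_trans by blast+
  \<comment> \<open>The central Gaussian binomial, extended by 0 so that each finite sum becomes a
    sum over all integers with a termwise limit.\<close>
  define c where "c n j = (if \<bar>j\<bar> \<le> int n then qbinom Q (n + n) (nat (int n + j)) else 0)" for n j
  have cb: "norm (c n j) \<le> U * (L * L)" for n j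
  proof -
    have "norm (qbinom Q N k) \<le> U * (L * L)" for N k
      using U0 L0 U L by (auto simp: qbinom_def divide_inverse norm_mult intro!: mult_mono)
    then show ?thesis using U0 L0 by (simp add: c_def)
  qed
  have clim: "(\<lambda>n. c n j) \<longlonglongrightarrow> P / (P * P)" for j
  proof -
    have "(\<lambda>n. qfact Q (n + n) / (qfact Q (nat (int n + j)) * qfact Q (nat (int n - j)))) \<longlonglongrightarrow> P / (P * P)"
    proof (intro tendsto_intros)
      show "(\<lambda>n. qfact Q (n + n)) \<longlonglongrightarrow> P"
        by (rule filterlim_compose[OF P]) (rule filterlim_at_top_mono[OF filterlim_ident], simp)
      have "filterlim (\<lambda>n. nat (int n + i)) sequentially sequentially" for i
        unfolding filterlim_at_top eventually_sequentially
        by (intro allI, rule_tac x="Z + nat \<bar>i\<bar>" in exI) auto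
      from this[of j] this[of "-j"]
      show "(\<lambda>n. qfact Q (nat (int n + j))) \<longlonglongrightarrow> P" "(\<lambda>n. qfact Q (nat (int n - j))) \<longlonglongrightarrow> P"
        using filterlim_compose[OF P] by auto
    qed (use P0 in simp)
    moreover have "eventually (\<lambda>n. qfact Q (n + n) / (qfact Q (nat (int n + j)) * qfact Q (nat (int n - j))) = c n j) sequentially"
      using eventually_ge_at_top[of "nat \<bar>j\<bar>"]
    proof eventually_elim
      case (elim n)
      then have "nat (int n + j) \<le> n + n" "n + n - nat (int n + j) = nat (int n - j)" "\<bar>j\<bar> \<le> int n"
        by auto
      then show ?case by (simp add: c_def qbinom_def)
    qed
    ultimately show ?thesis by (rule Lim_transform_eventually)
  qed
  have fin: "((\<lambda>j. theta_term x y j * c n j) has_sum theta_finite x y n n) UNIV" for n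
  proof -
    have "theta_finite x y n n = (\<Sum>j\<in>{- int n..int n}. theta_term x y j * c n j)"
      unfolding theta_finite_def Q_def[symmetric]
      by (rule sum.reindex_bij_witness[of _ "\<lambda>j. nat (int n + j)" "\<lambda>k. int k - int n"])
         (auto simp: c_def)
    then show ?thesis
      by (simp, intro has_sum_finite_neutralI) (auto simp: c_def)
  qed
  define r where "r = max (norm x) (norm y)"
  have r: "norm x \<le> r" "norm y \<le> r" "r < 1" "r \<ge> 0" using x y by (auto simp: r_def le_max_iff_disj)
  have "((\<lambda>j. theta_term x y j * (P / (P * P))) has_sum qpoch_inf x Q * qpoch_inf y Q) UNIV"
  proof (rule has_sum_int_dominated)
    show "(\<lambda>n. theta_term x y j * c n j) \<longlonglongrightarrow> theta_term x y j * (P / (P * P))" for j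
      by (intro tendsto_intros clim)
    show "norm (theta_term x y j * c n j) \<le> r ^ nat \<bar>j\<bar> * (U * (L * L))" for n j
      unfolding norm_mult using cb[of n j] norm_theta_term_le[OF r(1-3)] r by (intro mult_mono) auto
    show "(\<lambda>j::int. r ^ nat \<bar>j\<bar> * (U * (L * L))) summable_on UNIV"
      using summable_on_int_geometric[OF r(4,3)] by (rule summable_on_cmult_left)
    show "((\<lambda>j. theta_term x y j * c n j) has_sum theta_finite x y n n) UNIV" for n by (rule fin)
    show "(\<lambda>n. theta_finite x y n n) \<longlonglongrightarrow> qpoch_inf x Q * qpoch_inf y Q"
      using theta_finite_eq_prod[of x y] Q unfolding Q_def
      by (simp add: tendsto_mult qpoch_inf_LIMSEQ)
  qed
  \<comment> \<open>Multiplying by \<open>P\<close> cancels the limit of the binomials and supplies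
    the third product, \<open>qpoch_inf Q Q\<close>.\<close>
  from has_sum_cmult_left[OF this, of P] P0
  show ?thesis by (simp add: qpochs_inf_def P_def Q_def mult_ac)
qed

subsection \<open>The double sum\<close>

definition int_sign :: "int \<Rightarrow> complex" where
  "int_sign k = (if even k then 1 else -1)"

text \<open>The condition modulo 4 makes \<open>C = (A + B) div 2\<close> odd. So \<open>C\<close>
  is prime to 6 once 3 does not divide \<open>A + B\<close>, as needed to write it as
  \<open>6 * j + 1\<close> up to sign.\<close>

definition theta_lattice :: "(int \<times> int) set" where
  "theta_lattice = {(A, B). A mod 7 = 3 \<and> (B mod 5 = 1 \<or> B mod 5 = 4) \<and> (A + B) mod 4 = 2}"

text \<open>The sign depends on the parity of \<open>A\<close> and on \<open>B\<close> modulo 5, and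
  flips when exactly one of them changes. Each of the two cancelling involutions changes exactly
  one.\<close>

definition lattice_term :: "complex \<Rightarrow> int \<times> int \<Rightarrow> complex" where
  "lattice_term w = (\<lambda>(A, B). (if even A \<longleftrightarrow> B mod 5 = 1 then 1 else -1) * w ^ nat (15 * A\<^sup>2 + 21 * B\<^sup>2))"

text \<open>The square roots of 121 modulo 840 fall into eight classes modulo 210, in pairs of
  opposite sign. The member congruent to 2 modulo 3 is taken from each pair, with representative
  between -105 and 105 so that \<open>(x + 105) div 210\<close> recovers the quotient.\<close>

definition residues210 :: "int set" where
  "residues210 = {11, -31, 59, 101}"

lemma mod_210_mem_residues210:
  fixes x :: int
  assumes "odd x" "x mod 3 = 2" "x mod 5 = 1 \<or> x mod 5 = 4" "x mod 7 = 3 \<or> x mod 7 = 4"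
  shows "x - 210 * ((x + 105) div 210) \<in> residues210"
proof -
  define y where "y = x mod 210"
  have x: "x = 210 * (x div 210) + y" by (simp add: y_def)
  have "y mod 2 = 1" "y mod 3 = 2" "y mod 5 = 1 \<or> y mod 5 = 4" "y mod 7 = 3 \<or> y mod 7 = 4"
    unfolding y_def using assms by (simp_all add: mod_mod_cancel odd_iff_mod_2_eq_one)
  moreover have "\<forall>y\<in>set [0..209::int]. y mod 2 = 1 \<longrightarrow> y mod 3 = 2 \<longrightarrow> y mod 5 = 1 \<or> y mod 5 = 4 \<longrightarrow>
      y mod 7 = 3 \<or> y mod 7 = 4 \<longrightarrow> y = 11 \<or> y = 59 \<or> y = 101 \<or> y = 179"
    by code_simp
  moreover have "y \<in> set [0..209]" by (simp add: y_def)
  ultimately have "y = 11 \<or> y = 59 \<or> y = 101 \<or> y = 179" by blast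
  \<comment> \<open>The standard residue 179 is represented by -31, which raises the quotient by
    one.\<close>
  then have "x = 210 * (x div 210) + 11 \<or> x = 210 * (x div 210) + 59 \<or> x = 210 * (x div 210) + 101 \<or>
      x = 210 * (x div 210 + 1) + (- 31)"
    using x by (elim disjE) simp_all
  then have "\<exists>k. \<exists>r\<in>residues210. x = 210 * k + r"
    unfolding residues210_def by blast
  then obtain k r where "r \<in> residues210" "x = 210 * k + r" by blast
  moreover from this have "(x + 105) div 210 = k" unfolding residues210_def by auto
  ultimately show ?thesis by simp
qed

text \<open>Reindexing by the involution \<open>g\<close> makes the sum equal to its own
  negative.\<close>

lemma infsum_sign_reversing_eq_0:
  fixes f :: "'a \<Rightarrow> complex"
  assumes "\<And>a. a \<in> S \<Longrightarrow> g a \<in> S" "\<And>a. a \<in> S \<Longrightarrow> g (g a) = a" "\<And>a. a \<in> S \<Longrightarrow> f (g a) = - f a"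
  shows "infsum f S = 0"
proof -
  have "infsum (\<lambda>a. - f a) S = infsum f S"
    by (rule infsum_reindex_bij_witness[of _ g g]) (use assms in auto)
  then show ?thesis by (simp add: infsum_uminus)
qed

text \<open>A pair \<open>(A,B)\<close> with \<open>A+B\<close> divisible by 4 is replaced by \<open>(A,-B)\<close>, so that \<open>(A+B)/2\<close> becomes odd.\<close>

lemma infsum_lattice_odd:
  "infsum (lattice_term w) {(A, B) \<in> theta_lattice. odd A} =
   infsum (\<lambda>(n, m). (int_sign n * w ^ nat (15 * (14 * n + 3)\<^sup>2)) * (int_sign m * w ^ nat (21 * (10 * m + 1)\<^sup>2))) (UNIV \<times> UNIV)"
\<comment> \<open>With \<open>A = 14 * n + 3\<close> and \<open>B\<close> equal to
  \<open>10 * m + 1\<close> up to sign, the condition modulo 4 selects the plus sign exactly for odd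
  \<open>n + m\<close>. Then \<open>B mod 5 = 1\<close>, so for odd \<open>A\<close> the lattice
  sign is \<open>int_sign n * int_sign m\<close>.\<close>
proof (rule sym, rule infsum_reindex_bij_witness[of _
    "\<lambda>(A, B). ((A - 3) div 14, if B mod 5 = 1 then (B - 1) div 10 else (- B - 1) div 10)"
    "\<lambda>(n, m). (14 * n + 3, if odd (n + m) then 10 * m + 1 else - (10 * m + 1))"], goal_cases)
  case (1 a)
  obtain n m where a: "a = (n, m)" by force
  have "(- (10 * m + 1)) mod 5 \<noteq> 1" "(10 * m + 1) mod 5 = 1" by presburger+
  then show ?case by (simp add: a)
next
  case (2 a)
  obtain n m where a: "a = (n, m)" by force
  have "(14 * n + 3) mod 7 = 3" "(- (10 * m + 1)) mod 5 = 4" "(10 * m + 1) mod 5 = 1" by presburger+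
  moreover have "odd (n + m) \<Longrightarrow> (14 * n + 3 + (10 * m + 1)) mod 4 = 2"
    "even (n + m) \<Longrightarrow> (14 * n + 3 + - (10 * m + 1)) mod 4 = 2" by presburger+
  ultimately show ?case by (simp add: a theta_lattice_def del: minus_add_distrib add_uminus_conv_diff)
next
  case (3 b)
  obtain A B where b: "b = (A, B)" by force
  have AB: "A mod 7 = 3" "odd A" "(A + B) mod 4 = 2" "B mod 5 = 1 \<or> B mod 5 = 4"
    using 3 by (auto simp: b theta_lattice_def)
  define n where "n = (A - 3) div 14"
  have n: "A = 14 * n + 3" using AB(1,2) unfolding n_def by presburger
  show ?case
  proof (cases "B mod 5 = 1")
    case True
    define m where "m = (B - 1) div 10"
    have m: "B = 10 * m + 1" using True AB(2,3) unfolding m_def by presburger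
    have "odd (n + m)" using AB(3) unfolding n m by presburger
    then show ?thesis using True by (simp add: b n m del: even_add odd_add)
  next
    case False
    define m where "m = (- B - 1) div 10"
    have m: "B = - (10 * m + 1)" using False AB(2,3,4) unfolding m_def by presburger
    have "even (n + m)" using AB(3) unfolding n m by presburger
    then show ?thesis using False by (simp add: b n m del: even_add odd_add)
  qed
next
  case (5 a)
  obtain n m where a: "a = (n, m)" by force
  have "(- (10 * m + 1)) mod 5 \<noteq> 1" "(10 * m + 1) mod 5 = 1" by presburger+
  moreover have "nat (15 * (14 * n + 3)\<^sup>2 + 21 * (10 * m + 1)\<^sup>2) = nat (15 * (14 * n + 3)\<^sup>2) + nat (21 * (10 * m + 1)\<^sup>2)"
    by (simp add: nat_add_distrib)
  ultimately show ?case
    by (auto simp: a lattice_term_def int_sign_def power_add simp del: minus_add_distrib)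
qed auto

text \<open>If \<open>A\<close> is even then so is \<open>B\<close>, hence \<open>A - B\<close> and
  \<open>A + B\<close> agree modulo 4. Negating \<open>B\<close> swaps the residues 1 and 4 modulo
  5, which reverses the sign.\<close>

lemma infsum_lattice_even: "infsum (lattice_term w) {(A, B) \<in> theta_lattice. even A} = 0"
proof (rule infsum_sign_reversing_eq_0[of _ "\<lambda>(A, B). (A, - B)"], goal_cases)
  case (1 a)
  obtain A B where a: "a = (A, B)" by force
  have "(- B) mod 5 = 1 \<or> (- B) mod 5 = 4" "(A + - B) mod 4 = 2"
    using 1 unfolding a theta_lattice_def by (auto, presburger+)
  then show ?case using 1 by (auto simp: a theta_lattice_def)
next
  case (3 a)
  obtain A B where a: "a = (A, B)" by force
  have "(- B) mod 5 = 1 \<longleftrightarrow> B mod 5 \<noteq> 1"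
    using 3 unfolding a theta_lattice_def by (auto, presburger+)
  then show ?case by (auto simp: a lattice_term_def)
qed auto

text \<open>The map \<open>g\<close> is the reflection that negates \<open>A + B\<close> and fixes
  \<open>5 * A - 7 * B\<close>, so it preserves the quadratic form. It keeps \<open>A\<close> modulo
  7 and \<open>B\<close> modulo 5, while the parity of \<open>A\<close> changes because
  \<open>c\<close> is odd.\<close>

lemma infsum_lattice_3_dvd: "infsum (lattice_term w) {(A, B) \<in> theta_lattice. 3 dvd A + B} = 0"
proof -
  define g where "g = (\<lambda>(A::int, B::int). (A - 7 * ((A + B) div 6), B - 5 * ((A + B) div 6)))"
  have key: "g (A, B) \<in> theta_lattice \<and> 3 dvd fst (g (A, B)) + snd (g (A, B)) \<and> g (g (A, B)) = (A, B)
     \<and> lattice_term w (g (A, B)) = - lattice_term w (A, B)"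
    if AB: "(A, B) \<in> theta_lattice" "3 dvd A + B" for A B
  proof -
    have AB': "A mod 7 = 3" "(A + B) mod 4 = 2" "B mod 5 = 1 \<or> B mod 5 = 4"
      using AB(1) by (auto simp: theta_lattice_def)
    define c where "c = (A + B) div 6"
    have "s = 6 * (s div 6)" "odd (s div 6)" if "3 dvd s" "s mod 4 = 2" for s :: int
      using that by presburger+
    from this[OF AB(2) AB'(2)] have c: "A + B = 6 * c" and oc: "odd c" unfolding c_def by blast+
    have B: "B = 6 * c - A" using c by simp
    have g: "g (A, B) = (A - 7 * c, B - 5 * c)" by (simp add: g_def c_def)
    have sum: "(A - 7 * c) + (B - 5 * c) = 6 * (- c)" using c by simp
    have m: "(A - 7 * c) mod 7 = A mod 7" "(B - 5 * c) mod 5 = B mod 5" by (simp_all add: mod_eq_dvd_iff)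
    have "(6 * (- c)) mod 4 = 2" using oc by presburger
    then have "g (A, B) \<in> theta_lattice" using AB' unfolding g theta_lattice_def by (simp add: sum m)
    moreover have "3 dvd fst (g (A, B)) + snd (g (A, B))" unfolding g fst_conv snd_conv sum by simp
    moreover have "g (g (A, B)) = (A, B)"
      unfolding g unfolding g_def prod.case sum by simp
    moreover have "15 * (A - 7 * c)\<^sup>2 + 21 * (B - 5 * c)\<^sup>2 = 15 * A\<^sup>2 + 21 * B\<^sup>2"
      unfolding B by (simp add: power2_eq_square algebra_simps)
    then have "lattice_term w (g (A, B)) = - lattice_term w (A, B)"
      unfolding g lattice_term_def prod.case m using oc by auto
    ultimately show ?thesis by blast
  qed
  show ?thesis
    by (rule infsum_sign_reversing_eq_0[of _ g]) (use key in \<open>auto simp: case_prod_unfold\<close>)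
qed

text \<open>The coordinates \<open>C = (A + B) div 2\<close> and
  \<open>x = (5 * A - 7 * B) div 2\<close> diagonalise the form. Up to one common sign they are
  \<open>6 * j + 1\<close> and \<open>210 * k + r\<close>.\<close>

lemma infsum_lattice_not_3_dvd:
  "infsum (lattice_term w) {(A, B) \<in> theta_lattice. \<not> 3 dvd A + B} =
   infsum (\<lambda>(j, y). (int_sign j * w ^ nat (35 * (6 * j + 1)\<^sup>2)) * (case y of (k, r) \<Rightarrow> int_sign k * w ^ nat ((210 * k + r)\<^sup>2)))
     (UNIV \<times> (UNIV \<times> residues210))"
proof -
  \<comment> \<open>Solving for the old coordinates gives \<open>A = (7 * C + x) / 6\<close> and
    \<open>B = (5 * C - x) / 6\<close>. The divisions are exact because \<open>r\<close> is 5 modulo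
    6. As \<open>x\<close> is 4 modulo 7 when \<open>A\<close> is 3, the residues 11 and -31 take
    the plus sign, 59 and 101 the minus sign.\<close>
  define enc :: "int \<times> int \<times> int \<Rightarrow> int \<times> int" where
    "enc = (\<lambda>(j, k, r). if r \<in> {11, -31} then (35 * k + 7 * j + (r + 7) div 6, 5 * j - 35 * k + (5 - r) div 6)
      else (- (35 * k + 7 * j + (r + 7) div 6), - (5 * j - 35 * k + (5 - r) div 6)))"
  define split where "split j x = (j, (x + 105) div 210, x - 210 * ((x + 105) div 210))" for j x :: int
  define dec where
    "dec = (\<lambda>(A, B). let C = (A + B) div 2; x = (5 * A - 7 * B) div 2
       in if C mod 6 = 1 then split ((C - 1) div 6) x else split ((- C - 1) div 6) (- x))"
  have split: "split j (210 * k + r) = (j, k, r)" if "r \<in> residues210" for j k r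
  proof -
    have "(210 * k + r + 105) div 210 = k" using that unfolding residues210_def by auto
    then show ?thesis by (simp add: split_def)
  qed
  have dec_eq: "dec (A, B) = (j, k, r)"
    if "A + B = 2 * (6 * j + 1) \<and> 5 * A - 7 * B = 2 * (210 * k + r) \<or>
        A + B = 2 * (- (6 * j + 1)) \<and> 5 * A - 7 * B = 2 * (- (210 * k + r))" "r \<in> residues210" for A B j k r
    using that(1)
  proof
    assume h: "A + B = 2 * (6 * j + 1) \<and> 5 * A - 7 * B = 2 * (210 * k + r)"
    have "(6 * j + 1) mod 6 = 1" by presburger
    with h show ?thesis
      unfolding dec_def Let_def prod.case by (simp add: split[OF that(2)] del: distrib_left_numeral)
  next
    assume h: "A + B = 2 * (- (6 * j + 1)) \<and> 5 * A - 7 * B = 2 * (- (210 * k + r))"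
    have "(- (6 * j + 1)) mod 6 \<noteq> 1" by presburger
    with h show ?thesis
      unfolding dec_def Let_def prod.case
      by (simp add: split[OF that(2)] del: distrib_left_numeral mult_minus_right minus_add_distrib)
  qed
  have fwd: "dec (enc (j, k, r)) = (j, k, r) \<and> enc (j, k, r) \<in> theta_lattice \<and> \<not> 3 dvd fst (enc (j, k, r)) + snd (enc (j, k, r))
    \<and> lattice_term w (enc (j, k, r)) = (int_sign j * w ^ nat (35 * (6 * j + 1)\<^sup>2)) * (int_sign k * w ^ nat ((210 * k + r)\<^sup>2))"
    if r: "r \<in> residues210" for j k r
  proof -
    define A where "A = fst (enc (j, k, r))"
    define B where "B = snd (enc (j, k, r))"
    have enc: "enc (j, k, r) = (A, B)" by (simp add: A_def B_def)
    have cs: "r = 11 \<and> A = 35 * k + 7 * j + 3 \<and> B = 5 * j - 35 * k - 1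
      \<or> r = -31 \<and> A = 35 * k + 7 * j - 4 \<and> B = 5 * j - 35 * k + 6
      \<or> r = 59 \<and> A = - (35 * k + 7 * j + 11) \<and> B = - (5 * j - 35 * k - 9)
      \<or> r = 101 \<and> A = - (35 * k + 7 * j + 18) \<and> B = - (5 * j - 35 * k - 16)"
      using r unfolding A_def B_def enc_def residues210_def by auto
    have rel: "A + B = 2 * (6 * j + 1) \<and> 5 * A - 7 * B = 2 * (210 * k + r) \<or>
        A + B = 2 * (- (6 * j + 1)) \<and> 5 * A - 7 * B = 2 * (- (210 * k + r))"
      using cs by auto
    then have "A + B = 12 * j + 2 \<or> A + B = - (12 * j + 2)" by auto
    moreover have "s mod 4 = 2" "\<not> 3 dvd s" if "s = 12 * j + 2 \<or> s = - (12 * j + 2)" for s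
      using that by presburger+
    ultimately have sum: "(A + B) mod 4 = 2" "\<not> 3 dvd A + B" by blast+
    have B5: "B mod 5 = (if r = 11 \<or> r = 59 then 4 else 1)"
      using cs by (elim disjE conjE; simp only:; presburger)
    have A2: "even A \<longleftrightarrow> (even (j + k) \<longleftrightarrow> r = -31 \<or> r = 101)"
      using cs by (elim disjE conjE) auto
    have "(A, B) \<in> theta_lattice"
    proof -
      have "A mod 7 = 3" using cs by (elim disjE conjE; simp only:; presburger)
      moreover have "(A + B) mod 4 = 2" by (rule sum)
      ultimately show ?thesis using B5 by (simp add: theta_lattice_def)
    qed
    moreover have "\<not> 3 dvd A + B" by (rule sum)
    moreover have "lattice_term w (A, B) = (int_sign j * w ^ nat (35 * (6 * j + 1)\<^sup>2)) * (int_sign k * w ^ nat ((210 * k + r)\<^sup>2))"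
    proof -
      \<comment> \<open>The change of quadratic form is multiplied by 4 to avoid halves; the common
        sign disappears on squaring.\<close>
      have "4 * (15 * A\<^sup>2 + 21 * B\<^sup>2) = 35 * (A + B)\<^sup>2 + (5 * A - 7 * B)\<^sup>2"
        by (simp add: power2_eq_square algebra_simps)
      also have "\<dots> = 4 * (35 * (6 * j + 1)\<^sup>2 + (210 * k + r)\<^sup>2)"
        using rel
        by (elim disjE conjE) (simp_all only: power_mult_distrib power2_minus, simp_all)
      finally have "15 * A\<^sup>2 + 21 * B\<^sup>2 = 35 * (6 * j + 1)\<^sup>2 + (210 * k + r)\<^sup>2" by simp
      then have "nat (15 * A\<^sup>2 + 21 * B\<^sup>2) = nat (35 * (6 * j + 1)\<^sup>2) + nat ((210 * k + r)\<^sup>2)"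
        by (simp only: nat_add_distrib zero_le_power2 zero_le_mult_iff) (simp add: nat_add_distrib)
      moreover have "(even A \<longleftrightarrow> B mod 5 = 1) \<longleftrightarrow> even (j + k)"
        using A2 B5 r by (auto simp: residues210_def)
      ultimately show ?thesis
        by (auto simp: lattice_term_def int_sign_def power_add)
    qed
    ultimately show ?thesis unfolding enc using dec_eq[OF rel r] by simp
  qed
  have bwd: "enc (dec (A, B)) = (A, B) \<and> snd (snd (dec (A, B))) \<in> residues210"
    if AB: "(A, B) \<in> theta_lattice" "\<not> 3 dvd A + B" for A B
  proof -
    have AB': "A mod 7 = 3" "(A + B) mod 4 = 2" "B mod 5 = 1 \<or> B mod 5 = 4"
      using AB(1) by (auto simp: theta_lattice_def)
    define C where "C = (A + B) div 2"
    have "s = 2 * (s div 2)" "s div 2 mod 6 = 1 \<or> s div 2 mod 6 = 5" if "\<not> 3 dvd s" "s mod 4 = 2" for s :: int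
      using that by presburger+
    from this[OF AB(2) AB'(2)] have C: "A + B = 2 * C" and C6: "C mod 6 = 1 \<or> C mod 6 = 5"
      unfolding C_def by blast+
    have B: "B = 2 * C - A" using C by simp
    obtain a where a: "A = 7 * a + 3" using AB'(1) by (metis mult_div_mod_eq)
    obtain b where b: "B = 5 * b + 1 \<or> B = 5 * b + 4" using AB'(3) by (metis mult_div_mod_eq)
    from C6 show ?thesis
    proof
      assume C1: "C mod 6 = 1"
      define j where "j = (C - 1) div 6"
      have j: "C = 6 * j + 1" using C1 unfolding j_def by presburger
      \<comment> \<open>This is \<open>(5 * A - 7 * B) / 2\<close>. Its residues modulo 2 and 3 come
        from \<open>C\<close>, modulo 7 from \<open>A\<close>, modulo 5 from
        \<open>B\<close>.\<close>
      define x where "x = 6 * A - 7 * C"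
      define k where "k = (x + 105) div 210"
      define r where "r = x - 210 * k"
      have x7: "x = 7 * (6 * a - 6 * j + 1) + 4" by (simp add: x_def a j)
      have "odd x" "x mod 3 = 2" by (simp_all add: x_def j) presburger
      moreover have "x mod 7 = 4" unfolding x7 mod_mult_self4 by simp
      moreover have "x mod 5 = 1 \<or> x mod 5 = 4"
      proof -
        have "x = 5 * C - 6 * B" by (simp add: x_def B)
        then have "x = 5 * (C - 6 * b - 2) + 4 \<or> x = 5 * (C - 6 * b - 5) + 1" using b by auto
        then show ?thesis by (elim disjE; simp only: mod_mult_self4; simp)
      qed
      ultimately have r: "r \<in> residues210" unfolding r_def k_def by (intro mod_210_mem_residues210) auto
      have x: "x = 210 * k + r" by (simp add: r_def)
      \<comment> \<open>The residue modulo 7 decides which branch of \<open>enc\<close>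
        applies.\<close>
      have "r = 7 * (6 * a - 6 * j + 1 - 30 * k) + 4" unfolding r_def x7 by simp
      then have "r mod 7 = 4" by (simp only: mod_mult_self4) simp
      then have r': "r = 11 \<or> r = - 31" using r unfolding residues210_def by auto
      have "dec (A, B) = (j, k, r)"
        using r by (intro dec_eq) (use C j x in \<open>auto simp: x_def B\<close>)
      moreover have "enc (j, k, r) = (A, B)"
        using r' x unfolding enc_def x_def B j by auto
      ultimately show ?thesis using r by simp
    next
      assume C1: "C mod 6 = 5"
      define j where "j = (- C - 1) div 6"
      have j: "C = - (6 * j + 1)" using C1 unfolding j_def by presburger
      \<comment> \<open>Here \<open>x\<close> is negated along with \<open>C\<close>, so its residue
        modulo 7 is 3 and the other branch of \<open>enc\<close> applies.\<close>
      define x where "x = 7 * C - 6 * A"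
      define k where "k = (x + 105) div 210"
      define r where "r = x - 210 * k"
      have x7: "x = 7 * (- 6 * a - 6 * j - 4) + 3" by (simp add: x_def a j)
      have "odd x" "x mod 3 = 2" by (simp_all add: x_def j) presburger
      moreover have "x mod 7 = 3" unfolding x7 mod_mult_self4 by simp
      moreover have "x mod 5 = 1 \<or> x mod 5 = 4"
      proof -
        have "x = 6 * B - 5 * C" by (simp add: x_def B)
        then have "x = 5 * (6 * b - C + 1) + 1 \<or> x = 5 * (6 * b - C + 4) + 4" using b by auto
        then show ?thesis by (elim disjE; simp only: mod_mult_self4; simp)
      qed
      ultimately have r: "r \<in> residues210" unfolding r_def k_def by (intro mod_210_mem_residues210) auto
      have x: "x = 210 * k + r" by (simp add: r_def)
      have "r = 7 * (- 6 * a - 6 * j - 4 - 30 * k) + 3" unfolding r_def x7 by simp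
      then have "r mod 7 = 3" by (simp only: mod_mult_self4) simp
      then have r': "r = 59 \<or> r = 101" using r unfolding residues210_def by auto
      have "dec (A, B) = (j, k, r)"
        using r by (intro dec_eq) (use C j x in \<open>auto simp: x_def B\<close>)
      moreover have "enc (j, k, r) = (A, B)"
        using r' x unfolding enc_def x_def B j by auto
      ultimately show ?thesis using r by simp
    qed
  qed
  show ?thesis
    by (rule sym, rule infsum_reindex_bij_witness[of _ dec enc])
       (use fwd bwd in \<open>auto simp: case_prod_unfold mem_Times_iff\<close>)
qed

section \<open>Absolute convergence and the product identity for theta series\<close>

lemma abs_summable_on_Times_mult:
  fixes g :: "'a \<Rightarrow> 'c::{real_normed_field,banach}" and h :: "'b \<Rightarrow> 'c"
  assumes "g abs_summable_on A" "h abs_summable_on B"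
  shows "(\<lambda>(x, y). g x * h y) abs_summable_on A \<times> B"
  unfolding Infinite_Sum.abs_summable_on_Sigma_iff
  using assms by (simp add: norm_mult summable_on_cmult_right infsum_cmult_right summable_on_cmult_left infsum_nonneg abs_mult)

lemma infsum_Times_mult:
  fixes g :: "'a \<Rightarrow> complex" and h :: "'b \<Rightarrow> complex"
  assumes "g abs_summable_on A" "h abs_summable_on B"
  shows "infsum (\<lambda>(x, y). g x * h y) (A \<times> B) = infsum g A * infsum h B"
proof -
  have "(\<lambda>(x, y). g x * h y) summable_on A \<times> B"
    using abs_summable_on_Times_mult[OF assms] by (rule abs_summable_summable)
  from infsum_Sigma'_banach[OF this, symmetric]
  show ?thesis
    using abs_summable_summable[OF assms(1)] abs_summable_summable[OF assms(2)]
    by (simp add: infsum_cmult_right infsum_cmult_left)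
qed

lemma norm_int_sign [simp]: "norm (int_sign k) = 1"
  by (simp add: int_sign_def)

lemma abs_le_square_int: "\<bar>y\<bar> \<le> y\<^sup>2" for y :: int
  using self_le_power[of "\<bar>y\<bar>" 2] by (cases "y = 0") auto

lemma abs_summable_power_int:
  fixes w :: complex
  assumes "norm w < 1" "\<And>j::int. \<bar>j\<bar> \<le> e j"
  shows "(\<lambda>j. int_sign j * w ^ nat (e j)) abs_summable_on UNIV"
proof (rule Infinite_Sum.abs_summable_on_comparison_test')
  show "(\<lambda>j::int. norm w ^ nat \<bar>j\<bar>) summable_on UNIV"
    using assms by (intro summable_on_int_geometric) auto
  show "norm (int_sign j * w ^ nat (e j)) \<le> norm w ^ nat \<bar>j\<bar>" for j
    using assms(1) assms(2)[of j] by (simp add: norm_mult norm_power power_decreasing nat_mono)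
qed

lemma summable_lattice_term:
  assumes "norm w < 1"
  shows "lattice_term w summable_on S"
proof -
  have g: "(\<lambda>j::int. norm w ^ nat \<bar>j\<bar>) abs_summable_on UNIV"
    using summable_on_int_geometric[of "norm w"] assms by simp
  have "lattice_term w abs_summable_on UNIV \<times> UNIV"
  proof (rule Infinite_Sum.abs_summable_on_comparison_test)
    show "(\<lambda>(A, B). norm w ^ nat \<bar>A\<bar> * norm w ^ nat \<bar>B\<bar>) abs_summable_on UNIV \<times> (UNIV :: int set)"
      using g by (rule abs_summable_on_Times_mult[OF g])
    fix a :: "int \<times> int"
    obtain A B where a: "a = (A, B)" by force
    have "nat \<bar>A\<bar> + nat \<bar>B\<bar> \<le> nat (15 * A\<^sup>2 + 21 * B\<^sup>2)"
      using abs_le_square_int[of A] abs_le_square_int[of B] by linarith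
    then show "norm (lattice_term w a) \<le> norm (case a of (A, B) \<Rightarrow> norm w ^ nat \<bar>A\<bar> * norm w ^ nat \<bar>B\<bar>)"
      using assms
      by (auto simp: a lattice_term_def norm_mult norm_power power_decreasing simp flip: power_add)
  qed
  then have "lattice_term w summable_on UNIV"
    using abs_summable_summable by simp
  then show ?thesis
    by (rule summable_on_subset_banach) simp
qed

lemma infsum_split:
  fixes f :: "'a \<Rightarrow> complex"
  assumes "\<And>S. f summable_on S"
  shows "infsum f S = infsum f {a \<in> S. P a} + infsum f {a \<in> S. \<not> P a}"
proof -
  have "S = {a \<in> S. P a} \<union> {a \<in> S. \<not> P a}" by auto
  then show ?thesis
    by (metis (mono_tags, lifting) assms disjoint_iff infsum_Un_disjoint mem_Collect_eq)
qed

text \<open>For nonzero \<open>j\<close> the triangle inequality already gives that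
  \<open>a * j + b\<close> is at least \<open>j\<close> in absolute value. This provides geometric
  majorants for the theta series.\<close>

lemma abs_le_mult_square_linear:
  fixes a b c j :: int
  assumes "c \<ge> 1" "a \<ge> \<bar>b\<bar> + 1"
  shows "\<bar>j\<bar> \<le> c * (a * j + b)\<^sup>2"
proof (cases "j = 0")
  case False
  have "\<bar>j\<bar> * 1 \<le> \<bar>j\<bar> * (a - \<bar>b\<bar>)" using assms by (intro mult_left_mono) auto
  also have "\<dots> \<le> a * \<bar>j\<bar> - 1 * \<bar>b\<bar>"
    using mult_right_mono[of 1 "\<bar>j\<bar>" "\<bar>b\<bar>"] False by (simp add: algebra_simps)
  also have "\<dots> \<le> \<bar>a * j + b\<bar>" using assms by (simp add: abs_mult)
  also have "\<dots> \<le> (a * j + b)\<^sup>2" by (rule abs_le_square_int)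
  also have "\<dots> \<le> c * (a * j + b)\<^sup>2" using assms by (simp add: mult_le_cancel_right1)
  finally show ?thesis by simp
qed (use assms in simp)

lemma summable_residue_theta:
  fixes w :: complex
  assumes w: "norm w < 1"
  shows "(\<lambda>(k, r). int_sign k * w ^ nat ((210 * k + r)\<^sup>2)) abs_summable_on UNIV \<times> residues210"
proof (rule Infinite_Sum.abs_summable_on_comparison_test)
  have "(\<lambda>r::int. 1::real) abs_summable_on residues210"
    by (simp add: residues210_def)
  moreover have "(\<lambda>j::int. norm w ^ nat \<bar>j\<bar>) abs_summable_on UNIV"
    using summable_on_int_geometric[of "norm w"] assms by simp
  ultimately show "(\<lambda>(k, r). norm w ^ nat \<bar>k\<bar> * 1) abs_summable_on (UNIV :: int set) \<times> residues210"
    by (intro abs_summable_on_Times_mult)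
  fix y assume "y \<in> (UNIV :: int set) \<times> residues210"
  then obtain k r where y: "y = (k, r)" "r \<in> residues210" by auto
  then have "\<bar>k\<bar> \<le> (210 * k + r)\<^sup>2"
    using abs_le_mult_square_linear[of 1 r 210 k] by (auto simp: residues210_def)
  then show "norm (case y of (k, r) \<Rightarrow> int_sign k * w ^ nat ((210 * k + r)\<^sup>2)) \<le> norm (case y of (k, r) \<Rightarrow> norm w ^ nat \<bar>k\<bar> * 1)"
    using w by (simp add: y norm_mult norm_power power_decreasing nat_mono)
qed

theorem theta_product_identity:
  assumes w: "norm w < 1"
  shows "(\<Sum>\<^sub>\<infinity>n. int_sign n * w ^ nat (15 * (14 * n + 3)\<^sup>2)) * (\<Sum>\<^sub>\<infinity>m. int_sign m * w ^ nat (21 * (10 * m + 1)\<^sup>2)) =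
    (\<Sum>\<^sub>\<infinity>j. int_sign j * w ^ nat (35 * (6 * j + 1)\<^sup>2)) *
    (\<Sum>\<^sub>\<infinity>(k, r)\<in>UNIV \<times> residues210. int_sign k * w ^ nat ((210 * k + r)\<^sup>2))"
proof -
  have s: "(\<lambda>j. int_sign j * w ^ nat (c * (a * j + b)\<^sup>2)) abs_summable_on UNIV" if "c \<ge> 1" "a \<ge> \<bar>b\<bar> + 1" for a b c
    using abs_le_mult_square_linear[OF that] w by (intro abs_summable_power_int)
  note split = infsum_split[OF summable_lattice_term[OF w], of theta_lattice]
  have "infsum (lattice_term w) theta_lattice = infsum (lattice_term w) {(A, B) \<in> theta_lattice. odd A}"
    using split[of "\<lambda>(A, B). odd A"] infsum_lattice_even[of w] by (simp add: case_prod_unfold)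
  moreover have "infsum (lattice_term w) theta_lattice = infsum (lattice_term w) {(A, B) \<in> theta_lattice. \<not> 3 dvd A + B}"
    using split[of "\<lambda>(A, B). 3 dvd A + B"] infsum_lattice_3_dvd[of w] by (simp add: case_prod_unfold)
  ultimately show ?thesis
    unfolding infsum_lattice_odd infsum_lattice_not_3_dvd
    using infsum_Times_mult[OF s[of 15 3 14] s[of 21 1 10]] infsum_Times_mult[OF s[of 35 1 6] summable_residue_theta[OF w]]
    by simp
qed

subsection \<open>Square roots of 121 modulo 840\<close>

lemma enumerate_range:
  fixes f :: "nat \<Rightarrow> nat"
  assumes "strict_mono f"
  shows "enumerate (range f) n = f n"
proof -
  have inf: "infinite (range f)"
    using assms by (simp add: range_inj_infinite strict_mono_imp_inj_on)
  show ?thesis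
  proof (induction n)
    case 0
    show ?case unfolding enumerate_0
      by (rule Least_equality) (use assms in \<open>auto simp: strict_mono_less_eq\<close>)
  next
    case (Suc n)
    show ?case unfolding enumerate_Suc''[OF inf] Suc
      by (rule Least_equality) (use assms in \<open>auto simp: strict_mono_less_eq strict_mono_less\<close>)
  qed
qed

text \<open>The non-negative square roots of 121 modulo 840 in increasing order: eight in each block
  of length 210.\<close>

definition root_seq :: "nat \<Rightarrow> nat" where
  "root_seq n = 210 * (n div 8) + [11, 31, 59, 101, 109, 151, 179, 199] ! (n mod 8)"

lemma div_mod_8_cases:
  fixes n :: nat
  obtains p i where "n = 8 * p + i" "i \<in> {0, 1, 2, 3, 4, 5, 6, 7}"
proof
  show "n = 8 * (n div 8) + n mod 8" by simp
  have "n mod 8 < 8" by simp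
  then show "n mod 8 \<in> {0, 1, 2, 3, 4, 5, 6, 7}" by simp linarith
qed

lemma root_seq_div_mod:
  "i < 8 \<Longrightarrow> root_seq (8 * p + i) = 210 * p + [11, 31, 59, 101, 109, 151, 179, 199] ! i"
  by (simp add: root_seq_def)

lemma strict_mono_root_seq: "strict_mono root_seq"
proof (rule strict_monoI_Suc)
  fix n :: nat
  obtain p i where n: "n = 8 * p + i" "i \<in> {0, 1, 2, 3, 4, 5, 6, 7}" by (rule div_mod_8_cases)
  then have r: "root_seq n = 210 * p + [11, 31, 59, 101, 109, 151, 179, 199] ! i"
    by (auto simp only: root_seq_div_mod)
  show "root_seq n < root_seq (Suc n)"
  proof (cases "i = 7")
    case True
    then have "Suc n = 8 * Suc p + 0" using n(1) by simp
    then have "root_seq (Suc n) = 210 * Suc p + 11" by (simp only: root_seq_div_mod) simp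
    with r True show ?thesis by simp
  next
    case False
    have "Suc n = 8 * p + Suc i" "Suc i < 8" using n False by auto
    then have "root_seq (Suc n) = 210 * p + [11, 31, 59, 101, 109, 151, 179, 199] ! Suc i"
      by (simp only: root_seq_div_mod)
    with r n(2) False show ?thesis by auto
  qed
qed

lemma root_seq_square: "(root_seq n)\<^sup>2 = 840 * (((root_seq n)\<^sup>2 - 121) div 840) + 121"
proof -
  obtain p i where n: "n = 8 * p + i" "i \<in> {0, 1, 2, 3, 4, 5, 6, 7}" by (rule div_mod_8_cases)
  define r where "r = [11, 31, 59, 101, 109, 151, 179, 199::nat] ! i"
  have r: "root_seq n = 210 * p + r" "odd r" "r\<^sup>2 \<ge> 121" "840 dvd r\<^sup>2 - 121"
    using n root_seq_div_mod[of i p] unfolding r_def by auto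
  \<comment> \<open>As \<open>r\<close> is odd, one of the two factors is even; this turns the
    period 420 of the squares into 840.\<close>
  have "even (p * (105 * p + r))" using r(2) by simp
  then obtain t where t: "p * (105 * p + r) = 2 * t" by blast
  have "(root_seq n)\<^sup>2 = 420 * (p * (105 * p + r)) + r\<^sup>2"
    unfolding r(1) by (simp add: power2_eq_square algebra_simps)
  also have "\<dots> = 840 * t + r\<^sup>2" unfolding t by simp
  finally have "(root_seq n)\<^sup>2 - 121 = 840 * t + (r\<^sup>2 - 121)" "(root_seq n)\<^sup>2 \<ge> 121"
    using r(3) by auto
  then show ?thesis using r(4) by (auto elim!: dvdE)
qed

lemma root_seq_surj:
  assumes "y\<^sup>2 = 840 * m + 121"
  shows "\<exists>n. y = root_seq n"
proof -
  \<comment> \<open>Squares modulo 840 depend only on the root modulo 420, which leaves a finite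
    check; passing to modulus 210 comes afterwards.\<close>
  have "y mod 420 * (y mod 420) mod 840 = 121"
  proof -
    define a b where "a = y div 420" and "b = y mod 420"
    have y: "y = 420 * a + b" by (simp add: a_def b_def)
    have "b * b + 840 * (210 * a * a + a * b) = 840 * m + 121"
      using assms unfolding y by (simp add: power2_eq_square algebra_simps)
    then have "(b * b + 840 * (210 * a * a + a * b)) mod 840 = (840 * m + 121) mod 840" by simp
    then show ?thesis unfolding b_def[symmetric] mod_mult_self2 by simp
  qed
  then have "int (y mod 420) * int (y mod 420) mod 840 = 121"
    by (metis of_nat_mult of_nat_numeral zmod_int)
  moreover have "\<forall>b\<in>set [0..419::int]. b * b mod 840 = 121 \<longrightarrow>
      b mod 210 \<in> set [11, 31, 59, 101, 109, 151, 179, 199]"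
    by code_simp
  moreover have "int (y mod 420) \<in> set [0..419]" by simp
  ultimately have "int (y mod 420) mod 210 \<in> set [11, 31, 59, 101, 109, 151, 179, 199]" by blast
  moreover have "int (y mod 420) mod 210 = int (y mod 210)"
    by (simp add: mod_mod_cancel zmod_int)
  moreover have "z \<in> set [11, 31, 59, 101, 109, 151, 179, 199]"
    if "int z \<in> set [11, 31, 59, 101, 109, 151, 179, 199]" for z
    using that by auto
  ultimately have "y mod 210 \<in> set [11, 31, 59, 101, 109, 151, 179, 199]"
    by metis
  then obtain i where "i < length [11, 31, 59, 101, 109, 151, 179, 199::nat]"
      "y mod 210 = [11, 31, 59, 101, 109, 151, 179, 199] ! i"
    unfolding in_set_conv_nth by metis
  moreover from this have "i < 8" by simp
  ultimately have "root_seq (8 * (y div 210) + i) = 210 * (y div 210) + y mod 210"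
    by (simp only: root_seq_div_mod)
  then have "y = root_seq (8 * (y div 210) + i)" by simp
  then show ?thesis ..
qed

text \<open>Squaring is monotone on the naturals, so the exponents come in the order of their
  roots.\<close>

lemma enumerate_square_exponents:
  "840 * enumerate square_exponents n + 121 = (root_seq n)\<^sup>2"
proof -
  define f where "f n = ((root_seq n)\<^sup>2 - 121) div 840" for n
  have f: "(root_seq n)\<^sup>2 = 840 * f n + 121" for n
    unfolding f_def by (rule root_seq_square)
  have "strict_mono f"
  proof (rule strict_monoI)
    fix m n :: nat assume "m < n"
    then have "(root_seq m)\<^sup>2 < (root_seq n)\<^sup>2"
      using strict_mono_root_seq by (simp add: strict_mono_less power_strict_mono)
    then show "f m < f n" by (simp add: f)
  qed
  moreover have "square_exponents = range f"
  proof (intro equalityI subsetI)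
    fix m assume "m \<in> square_exponents"
    then obtain y where "840 * m + 121 = y\<^sup>2"
      by (auto simp: square_exponents_def is_nth_power_def)
    moreover from this obtain n where "y = root_seq n" using root_seq_surj by metis
    ultimately show "m \<in> range f" using f[of n] by auto
  next
    fix m assume "m \<in> range f"
    then obtain n where "840 * m + 121 = (root_seq n)\<^sup>2" by (auto simp: f)
    then show "m \<in> square_exponents" by (auto simp: square_exponents_def)
  qed
  ultimately have "enumerate square_exponents n = f n"
    by (metis enumerate_range)
  then show ?thesis by (simp add: f)
qed

text \<open>Every root is the absolute value of \<open>210 * k + r\<close> for one pair, where
  \<open>210 * k\<close> is up to sign the multiple of 210 nearest to the root. The last four roots
  of a block are nearest to the next multiple, so \<open>k\<close> has absolute value
  \<open>(n + 4) div 8\<close>, whence the sign.\<close>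

lemma has_sum_root_seq:
  "((\<lambda>n. (-1) ^ ((n + 4) div 8) * w ^ (root_seq n)\<^sup>2) has_sum s) UNIV \<longleftrightarrow>
   ((\<lambda>(k, r). int_sign k * w ^ nat ((210 * k + r)\<^sup>2)) has_sum s) (UNIV \<times> residues210)"
proof -
  define enc :: "nat \<Rightarrow> int \<times> int" where
    "enc n = (let p = int (n div 8) in
       [(p, 11), (- p, - 31), (p, 59), (p, 101), (- (p + 1), 101), (- (p + 1), 59), (p + 1, - 31), (- (p + 1), 11)] ! (n mod 8))" for n
  \<comment> \<open>For given \<open>r\<close> the sign of \<open>k\<close> tells the half of the
    block; the roles are reversed for the negative representative -31.\<close>
  define dec :: "int \<times> int \<Rightarrow> nat" where
    "dec = (\<lambda>(k, r). if r = 11 then if k \<ge> 0 then 8 * nat k + 0 else 8 * nat (- k - 1) + 7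
       else if r = - 31 then if k \<le> 0 then 8 * nat (- k) + 1 else 8 * nat (k - 1) + 6
       else if r = 59 then if k \<ge> 0 then 8 * nat k + 2 else 8 * nat (- k - 1) + 5
       else if k \<ge> 0 then 8 * nat k + 3 else 8 * nat (- k - 1) + 4)"
  have enc_eq: "enc (8 * p + i) = [(int p, 11), (- int p, - 31), (int p, 59), (int p, 101), (- (int p + 1), 101),
     (- (int p + 1), 59), (int p + 1, - 31), (- (int p + 1), 11)] ! i" if "i < 8" for p i
    using that by (simp add: enc_def Let_def)
  have fwd: "dec (enc n) = n \<and> enc n \<in> UNIV \<times> residues210 \<and>
     (case enc n of (k, r) \<Rightarrow> int_sign k * w ^ nat ((210 * k + r)\<^sup>2)) = (-1) ^ ((n + 4) div 8) * w ^ (root_seq n)\<^sup>2" for n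
  proof -
    obtain p i where n: "n = 8 * p + i" "i \<in> {0, 1, 2, 3, 4, 5, 6, 7}" by (rule div_mod_8_cases)
    then have tn: "enc n = [(int p, 11), (- int p, - 31), (int p, 59), (int p, 101), (- (int p + 1), 101),
      (- (int p + 1), 59), (int p + 1, - 31), (- (int p + 1), 11)] ! i"
      by (auto simp only: enc_eq)
    have rn: "root_seq n = 210 * p + [11, 31, 59, 101, 109, 151, 179, 199] ! i"
      using n by (auto simp only: root_seq_div_mod)
    have "dec (enc n) = n" "enc n \<in> UNIV \<times> residues210"
      using n(2) unfolding tn by (auto simp: n(1) dec_def residues210_def nat_add_distrib)
    moreover have "(case enc n of (k, r) \<Rightarrow> int_sign k) = (-1) ^ ((n + 4) div 8)"
      using n(2) unfolding tn by (auto simp: n(1) int_sign_def minus_one_power_iff)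
    moreover have "(case enc n of (k, r) \<Rightarrow> \<bar>210 * k + r\<bar>) = int (root_seq n)"
      using n(2) unfolding tn rn by auto
    moreover have "nat (z\<^sup>2) = y\<^sup>2" if "\<bar>z\<bar> = int y" for z y
      using that by (metis nat_int of_nat_power power2_abs)
    ultimately show ?thesis by (auto simp: case_prod_unfold)
  qed
  have bwd: "enc (dec (k, r)) = (k, r)" if "r \<in> residues210" for k r
    using that unfolding residues210_def dec_def
    by (auto simp: enc_eq enc_eq[of 0, simplified] enc_eq[of 1, simplified] enc_eq[of 2, simplified]
        enc_def[of 0] enc_def[of "Suc 0"] enc_def[of "Suc (Suc 0)"] enc_def[of 3] Let_def)
  show ?thesis
    by (rule has_sum_reindex_bij_witness[of _ dec enc]) (use fwd bwd in auto)
qed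

subsection \<open>From theta series to products\<close>

text \<open>Brings a quadratic exponent into triple product form; doubling the equation avoids
  halving the triangular numbers.\<close>

lemma int_sign_power_eq_theta_term:
  assumes "2 * e = 2 * int c + int s * (j * (j + 1)) + int t * (j * (j - 1))"
  shows "int_sign j * w ^ nat e = w ^ c * theta_term (w ^ s) (w ^ t) j"
proof -
  obtain a b where ab: "j * (j + 1) div 2 = int a" "j * (j - 1) div 2 = int b"
    "2 * int a = j * (j + 1)" "2 * int b = j * (j - 1)"
    by (rule nat_triangle)
  have "e = int (c + s * a + t * b)"
    using assms unfolding ab(3,4)[symmetric] by (simp add: algebra_simps)
  then have "nat e = c + s * a + t * b" by (simp only: nat_int)
  moreover have "(-1) ^ nat \<bar>j\<bar> = int_sign j"
    by (simp add: int_sign_def minus_one_power_iff even_nat_iff)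
  ultimately show ?thesis
    unfolding theta_term_def ab nat_int by (simp add: power_add power_mult)
qed

lemma infsum_theta:
  fixes w :: complex
  assumes w: "norm w < 1" and st: "s > 0" "t > 0"
    and e: "\<And>j. 2 * e j = 2 * int c + int s * (j * (j + 1)) + int t * (j * (j - 1))"
  shows "(\<Sum>\<^sub>\<infinity>j. int_sign j * w ^ nat (e j)) = w ^ c * qpochs_inf [w ^ s, w ^ t, w ^ (s + t)] (w ^ (s + t))"
proof -
  have "norm (w ^ s) < 1" "norm (w ^ t) < 1"
    using w st by (simp_all add: norm_power power_less_one_iff)
  from has_sum_cmult_right[OF jacobi_triple_product[OF this], of "w ^ c"]
  show ?thesis
    unfolding int_sign_power_eq_theta_term[OF e] by (simp add: infsumI power_add)
qed

text \<open>The factors \<open>1 - q ^ Suc i\<close> are sorted by \<open>i\<close> modulo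
  \<open>M\<close>. This is exact for partial products of length \<open>n * M\<close>, which form a
  subsequence with the same limit.\<close>

lemma qpoch_inf_dissect:
  assumes q: "norm q < 1" and M: "M > 0"
  shows "qpoch_inf q q = (\<Prod>r<M. qpoch_inf (q ^ Suc r) (q ^ M))"
proof -
  have qM: "norm (q ^ M) < 1" using q M by (simp add: norm_power power_less_one_iff)
  have "(\<lambda>n. \<Prod>i<n * M. 1 - q * q ^ i) \<longlonglongrightarrow> qpoch_inf q q"
    by (rule filterlim_compose[OF qpoch_inf_LIMSEQ[OF q]])
       (use M in \<open>auto intro!: filterlim_at_top_mono[OF filterlim_ident]\<close>)
  moreover have "(\<Prod>i<n * M. 1 - q * q ^ i) = (\<Prod>r<M. \<Prod>i<n. 1 - q ^ Suc r * (q ^ M) ^ i)" for n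
  proof -
    have "(\<Prod>i<n * M. 1 - q * q ^ i) = (\<Prod>m<n. \<Prod>i = m * M..<m * M + M. 1 - q * q ^ i)"
      by (rule prod.nat_group[symmetric])
    also have "\<dots> = (\<Prod>m<n. \<Prod>r<M. 1 - q ^ Suc r * (q ^ M) ^ m)"
    proof (rule prod.cong[OF refl])
      fix m
      have "q ^ Suc (i - m * M) * (q ^ M) ^ m = q * q ^ i" if "m * M \<le> i" for i
        using that by (simp add: mult.commute[of m] flip: power_mult power_add)
      then show "(\<Prod>i = m * M..<m * M + M. 1 - q * q ^ i) = (\<Prod>r<M. 1 - q ^ Suc r * (q ^ M) ^ m)"
        by (intro prod.reindex_bij_witness[of _ "\<lambda>r. m * M + r" "\<lambda>i. i - m * M"])
           (auto simp del: power_Suc)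
    qed
    also have "\<dots> = (\<Prod>r<M. \<Prod>i<n. 1 - q ^ Suc r * (q ^ M) ^ i)" by (rule prod.swap)
    finally show ?thesis .
  qed
  moreover have "(\<lambda>n. \<Prod>r<M. \<Prod>i<n. 1 - q ^ Suc r * (q ^ M) ^ i) \<longlonglongrightarrow> (\<Prod>r<M. qpoch_inf (q ^ Suc r) (q ^ M))"
    by (intro tendsto_prod qpoch_inf_LIMSEQ qM)
  ultimately show ?thesis by (simp add: LIMSEQ_unique)
qed

theorem theorem3:
  fixes q :: complex
  assumes "norm q < 1"
  shows "(\<lambda>n. (-1) ^ ((n + 4) div 8) * q ^ enumerate square_exponents n) sums
    (qpochs_inf [q ^ 2, q ^ 5, q ^ 7] (q ^ 7) / qpochs_inf [q, q ^ 4] (q ^ 5))"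
proof (cases "q = 0")
  \<comment> \<open>An exponential is never 0, so this case has no root \<open>w\<close> as used
    below. Only \<open>n = 0\<close> has exponent 0, and that term is 1.\<close>
  case True
  have "enumerate square_exponents n = 0 \<longleftrightarrow> n = 0" for n
  proof -
    have "enumerate square_exponents 0 = 0"
      using enumerate_square_exponents[of 0] by (simp add: root_seq_def)
    moreover have "n > 0 \<Longrightarrow> enumerate square_exponents n > enumerate square_exponents 0"
      by (rule enumerate_mono[OF _ infinite_square_exponents])
    ultimately show ?thesis by (cases "n = 0") auto
  qed
  then have "(\<lambda>n. (-1) ^ ((n + 4) div 8) * q ^ enumerate square_exponents n) = (\<lambda>n. if n = 0 then 1 else 0)"
    using True by (auto simp: fun_eq_iff power_0_left)
  moreover have "qpoch_inf 0 p = 1" for p by (simp add: qpoch_inf_def)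
  ultimately show ?thesis
    using True sums_single[of 0 "\<lambda>_. 1::complex"] by (simp add: qpochs_inf_def)
next
  case False
  \<comment> \<open>An 840th root of \<open>q\<close>, so that \<open>q\<close> to the power of the
    \<open>n\<close>-th exponent becomes \<open>w\<close> to the power of a square minus
    121.\<close>
  define w where "w = exp (Ln q / 840)"
  have w840: "w ^ 840 = q"
    using False by (simp add: w_def flip: exp_of_nat_mult)
  have w0: "w \<noteq> 0" by (simp add: w_def)
  have w: "norm w < 1"
  proof (rule ccontr)
    assume "\<not> norm w < 1"
    then have "norm (w ^ 840) \<ge> 1" unfolding norm_power by (intro one_le_power) simp
    then show False using assms w840 by simp
  qed
  have pw: "w ^ (840 * k) = q ^ k" for k by (simp add: power_mult w840)
  define X where "X = (\<Sum>\<^sub>\<infinity>(k, r)\<in>UNIV \<times> residues210. int_sign k * w ^ nat ((210 * k + r)\<^sup>2))"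
  \<comment> \<open>The offset 135 is the exponent at \<open>n = 0\<close>. The parameters
    \<open>s\<close> and \<open>t\<close> have as sum and difference twice the quadratic and twice
    the linear coefficient; likewise in the next two expansions.\<close>
  have T7: "(\<Sum>\<^sub>\<infinity>n. int_sign n * w ^ nat (15 * (14 * n + 3)\<^sup>2)) = w ^ 135 * qpochs_inf [q ^ 5, q ^ 2, q ^ 7] (q ^ 7)"
    using infsum_theta[OF w, of "840 * 5" "840 * 2" "\<lambda>n. 15 * (14 * n + 3)\<^sup>2" 135] pw[of 5] pw[of 2] pw[of 7]
    by (simp add: power2_eq_square algebra_simps)
  have T5: "(\<Sum>\<^sub>\<infinity>n. int_sign n * w ^ nat (21 * (10 * n + 1)\<^sup>2)) = w ^ 21 * qpochs_inf [q ^ 3, q ^ 2, q ^ 5] (q ^ 5)"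
    using infsum_theta[OF w, of "840 * 3" "840 * 2" "\<lambda>n. 21 * (10 * n + 1)\<^sup>2" 21] pw[of 3] pw[of 2] pw[of 5]
    by (simp add: power2_eq_square algebra_simps)
  have T3: "(\<Sum>\<^sub>\<infinity>n. int_sign n * w ^ nat (35 * (6 * n + 1)\<^sup>2)) = w ^ 35 * qpochs_inf [q ^ 2, q, q ^ 3] (q ^ 3)"
    using infsum_theta[OF w, of "840 * 2" "840 * 1" "\<lambda>n. 35 * (6 * n + 1)\<^sup>2" 35] pw[of 2] pw[of 1] pw[of 3]
    by (simp add: power2_eq_square algebra_simps)
  \<comment> \<open>Euler's product is dissected modulo 3 and then modulo 5, which exposes the
    denominator of the claim.\<close>
  have "qpochs_inf [q ^ 2, q, q ^ 3] (q ^ 3) = qpoch_inf q q"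
    using qpoch_inf_dissect[OF assms, of 3] by (simp add: qpochs_inf_def eval_nat_numeral mult_ac)
  also have "\<dots> = qpochs_inf [q, q ^ 4] (q ^ 5) * qpochs_inf [q ^ 3, q ^ 2, q ^ 5] (q ^ 5)"
    using qpoch_inf_dissect[OF assms, of 5] by (simp add: qpochs_inf_def eval_nat_numeral mult_ac)
  finally have T3': "qpochs_inf [q ^ 2, q, q ^ 3] (q ^ 3) = \<dots>" .
  have nz: "qpochs_inf [q, q ^ 4] (q ^ 5) \<noteq> 0" "qpochs_inf [q ^ 3, q ^ 2, q ^ 5] (q ^ 5) \<noteq> 0"
    using qpoch_inf_power_nonzero[OF assms, of _ 5] qpoch_inf_power_nonzero[OF assms, of 1 5]
    by (auto simp: qpochs_inf_def)
  have eq: "w ^ 35 * w ^ 121 * (qpochs_inf [q ^ 2, q ^ 5, q ^ 7] (q ^ 7) * qpochs_inf [q ^ 3, q ^ 2, q ^ 5] (q ^ 5)) =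
     w ^ 35 * (qpochs_inf [q, q ^ 4] (q ^ 5) * qpochs_inf [q ^ 3, q ^ 2, q ^ 5] (q ^ 5) * X)"
  proof -
    \<comment> \<open>The offsets of the two double sums agree up to 121, the shift between a square
      and 840 times its exponent.\<close>
    have "w ^ 35 * w ^ 121 = w ^ 135 * w ^ 21" by (simp flip: power_add)
    moreover have "qpochs_inf [q ^ 2, q ^ 5, q ^ 7] (q ^ 7) = qpochs_inf [q ^ 5, q ^ 2, q ^ 7] (q ^ 7)"
      by (simp add: qpochs_inf_def)
    ultimately show ?thesis
      using theta_product_identity[OF w] unfolding X_def[symmetric] T7 T5 T3 T3' by (simp add: mult_ac)
  qed
  have cancel: "X / v = P / S" if "u * v * (P * R) = u * (S * R * X)" "u \<noteq> 0" "v \<noteq> 0" "R \<noteq> 0" "S \<noteq> 0"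
    for u v P R S :: complex
  proof -
    have "(u * R) * (X * S) = (u * R) * (P * v)" using that(1) by (simp only: mult_ac)
    then have "X * S = P * v" using that(2,4) by simp
    then show ?thesis using that(3,5) by (simp add: frac_eq_eq)
  qed
  have X: "X / w ^ 121 = qpochs_inf [q ^ 2, q ^ 5, q ^ 7] (q ^ 7) / qpochs_inf [q, q ^ 4] (q ^ 5)"
    by (rule cancel[OF eq]) (use nz w0 in simp_all)
  have "((\<lambda>(k, r). int_sign k * w ^ nat ((210 * k + r)\<^sup>2)) has_sum X) (UNIV \<times> residues210)"
    unfolding X_def by (rule has_sum_infsum[OF abs_summable_summable[OF summable_residue_theta[OF w]]])
  then have "(\<lambda>n. (-1) ^ ((n + 4) div 8) * w ^ (root_seq n)\<^sup>2) sums X"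
    unfolding has_sum_root_seq[symmetric] by (rule has_sum_imp_sums)
  then have "(\<lambda>n. (-1) ^ ((n + 4) div 8) * w ^ (root_seq n)\<^sup>2 / w ^ 121) sums (X / w ^ 121)"
    by (rule sums_divide)
  moreover have "(-1) ^ ((n + 4) div 8) * w ^ (root_seq n)\<^sup>2 / w ^ 121 = (-1) ^ ((n + 4) div 8) * q ^ enumerate square_exponents n" for n
    unfolding enumerate_square_exponents[symmetric] power_add pw using w0 by simp
  ultimately show ?thesis by (simp add: X)
qed

end
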